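(* Let $a$ and $b$ be co-prime positive integers satisfying $1<a<b$. Then $$\overline{\bigcup_{k\in\mathbb{Z}}a^k\mathcal{F}_{(a,b)}}=\mathbb{R}^+,$$ where $\mathbb{R}^+$ is the set of all positive real numbers and the closure is taken in $\mathbb{R}^+$; that is, $\bigcup_{k\in\mathbb{Z}}a^k\mathcal{F}_{(a,b)}$ is dense in $\mathbb{R}^+$.
   Context: $\mathbb{N}=\{0,1,2,\dots\}$. For co-prime integers $1<a<b$, $\mathcal{F}_{(a,b)}$ is the set of rational numbers $a^q/b^p$, where $p\in\mathbb{N}$ and $q=\lceil p\log b/\log a\rceil$ is the smallest nonnegative integer with $1\le a^q/b^p$. For $k\in\mathbb{Z}$, $a^k\mathcal{F}_{(a,b)}=\{a^k\cdot f: f\in\mathcal{F}_{(a,b)}\}$. $\mathbb{R}^+$ has the usual topology. *)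

theory Defs
  imports "HOL-Analysis.Analysis"
begin

definition ceil_exp :: "nat \<Rightarrow> nat \<Rightarrow> nat \<Rightarrow> nat" where
  "ceil_exp a b p = nat \<lceil>real p * ln (real b) / ln (real a)\<rceil>"

text \<open>The rational numbers \<open>a^q / b^p\<close> are represented inside the reals.\<close>

definition frac_set :: "nat \<Rightarrow> nat \<Rightarrow> real set" where
  "frac_set a b = {real a ^ q / real b ^ p | p q. q = ceil_exp a b p}"

lemma one_le_frac_iff:
  fixes a b p q :: nat
  assumes "1 < a" "a < b"
  shows "1 \<le> real a ^ q / real b ^ p \<longleftrightarrow> ceil_exp a b p \<le> q"
proof -
  have pos: "0 < ln (real a)" "0 < real a" "0 < real b"
    using assms by auto
  have "1 \<le> real a ^ q / real b ^ p \<longleftrightarrow> real b ^ p \<le> real a ^ q"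
    using pos by (simp add: divide_simps)
  also have "\<dots> \<longleftrightarrow> ln (real b ^ p) \<le> ln (real a ^ q)"
    using pos by (intro ln_le_cancel_iff[symmetric]) auto
  also have "\<dots> \<longleftrightarrow> real p * ln (real b) / ln (real a) \<le> real q"
    using pos by (simp add: ln_realpow pos_divide_le_eq)
  also have "\<dots> \<longleftrightarrow> ceil_exp a b p \<le> q"
    by (simp add: ceil_exp_def nat_le_iff ceiling_le_iff)
  finally show ?thesis .
qed

lemma ceil_exp_eq_Least:
  fixes a b p :: nat
  assumes "1 < a" "a < b"
  shows "ceil_exp a b p = (LEAST q. 1 \<le> real a ^ q / real b ^ p)"
  by (rule Least_equality[symmetric]) (simp_all add: one_le_frac_iff[OF assms])

end

theory Submission
  imports Defs
begin

text \<open>In the logarithmic scale to base \<open>a\<close>, the set consists of the numbers \<open>h - p \<theta>\<close> with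
  \<open>h\<close> an integer, \<open>p\<close> a natural number and \<open>\<theta> = log a b\<close>. Coprimality makes \<open>\<theta>\<close> irrational, so
  these numbers are dense in the real line by Kronecker's theorem, and \<open>y \<mapsto> a powr y\<close>
  carries this density over to the positive reals.\<close>

lemma powr_nat_mult_log:
  fixes a b :: real
  assumes "0 < a" "a \<noteq> 1" "0 < b"
  shows "a powr (real n * log a b) = b ^ n"
proof -
  have "real n * log a b = log a (b ^ n)"
    using assms by (simp add: log_nat_power)
  then show ?thesis
    using assms by simp
qed

text \<open>If the logarithm were m / n, then b ^ n = a ^ m would be coprime to itself and hence 1,
  which is impossible for b > 1 and n > 0.\<close>

lemma log_coprime_irrational:
  fixes a b :: nat
  assumes "coprime a b" "1 < a" "1 < b"
  shows "log (real a) (real b) \<notin> \<rat>"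
proof
  assume "log (real a) (real b) \<in> \<rat>"
  then obtain m n :: nat where n: "n \<noteq> 0" and mn: "\<bar>log (real a) (real b)\<bar> = real m / real n"
    by (rule Rats_abs_nat_div_natE)
  \<comment> \<open>The absolute value drops out because a, b > 1 make the logarithm
    positive.\<close>
  have "real n * log (real a) (real b) = real m"
    using mn n assms by (simp add: field_simps)
  then have "real b ^ n = real a ^ m"
    using powr_nat_mult_log [of "real a" "real b" n] assms by (simp add: powr_realpow)
  then have "b ^ n = a ^ m"
    by (metis of_nat_eq_iff of_nat_power)
  moreover have "coprime (a ^ m) (b ^ n)"
    using assms(1) by simp
  ultimately have "b ^ n = 1"
    by simp
  then show False
    using n assms(3) by simp
qed

lemma closure_int_minus_nat_multiples:
  fixes \<theta> :: real
  assumes "\<theta> \<notin> \<rat>"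
  shows "closure {of_int h - real p * \<theta> | h p. True} = UNIV"
proof -
  have "\<exists>y\<in>{of_int h - real p * \<theta> | h p. True}. dist y x < e" if e: "e > 0" for x e :: real
  proof -
    \<comment> \<open>Kronecker's theorem is aimed at \<open>- x\<close>: negating an approximation
      k \<theta> - h of \<open>- x\<close> gives h - k \<theta> close to x, and \<open>k > 0\<close>
      lets \<open>nat k\<close> serve as the natural coefficient.\<close>
    obtain h k where "k > 0" and hk: "\<bar>of_int k * \<theta> - of_int h - (- x)\<bar> < e"
      using sequence_of_fractional_parts_is_dense [OF assms e, where \<alpha> = "- x"] by blast
    then have "dist (of_int h - real (nat k) * \<theta>) x < e"
      by (simp add: dist_real_def)
    then show ?thesis
      by blast
  qed
  then show ?thesis
    by (auto simp: closure_approachable)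
qed

text \<open>Scaling by the power h - q of a replaces the numerator a ^ q by a ^ h, so the single
  fraction with denominator b ^ p yields every integer exponent h.\<close>

lemma powr_in_scaled_frac_set:
  fixes a b p :: nat and h :: int
  assumes "1 < a" "1 < b"
  shows "real a powr (of_int h - real p * log a b)
    \<in> (\<Union>k::int. (\<lambda>f. real a powi k * f) ` frac_set a b)"
proof -
  define q where "q = ceil_exp a b p"
  have "real a powr (real p * log a b) = real b ^ p"
    using assms by (simp add: powr_nat_mult_log)
  then have "real a powr (of_int h - real p * log a b) = real a powi h / real b ^ p"
    using assms by (simp add: powr_diff powr_real_of_int')
  also have "\<dots> = real a powi (h - int q) * (real a ^ q / real b ^ p)"
    using assms by (simp add: power_int_diff)
  finally show ?thesis
    unfolding frac_set_def q_def by blast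
qed

theorem corollary7p1p2:
  fixes a b :: nat
  assumes "coprime a b" and "1 < a" and "a < b"
  shows "top_of_set {0<..} closure_of (\<Union>k::int. (\<lambda>f. real a powi k * f) ` frac_set a b)
    = {0<..}"
proof -
  define S where "S = (\<Union>k::int. (\<lambda>f. real a powi k * f) ` frac_set a b)"
  define L where "L = {of_int h - real p * log a b | h p. True}"
  have b: "1 < b"
    using assms by simp
  have S_pos: "S \<subseteq> {0<..}"
    using assms by (auto simp: S_def frac_set_def)
  have L: "closure L = UNIV"
    unfolding L_def using closure_int_minus_nat_multiples log_coprime_irrational assms b by blast
  \<comment> \<open>A continuous map sends the closure of L into any closed set containing the image
    of L; here that closed set is \<open>closure S\<close>.\<close>
  have "(\<lambda>y. real a powr y) ` closure L \<subseteq> closure S"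
  proof (rule image_closure_subset)
    show "continuous_on (closure L) (\<lambda>y. real a powr y)"
      using assms by (intro continuous_intros) auto
    have "(\<lambda>y. real a powr y) ` L \<subseteq> S"
      unfolding L_def S_def using powr_in_scaled_frac_set [OF assms(2) b] by blast
    then show "(\<lambda>y. real a powr y) ` L \<subseteq> closure S"
      using closure_subset by blast
  qed simp
  then have "real a powr log a x \<in> closure S" for x
    using L by blast
  then have "x \<in> closure S" if "x > 0" for x
    using that assms powr_log_cancel [of "real a" x] by (metis less_irrefl less_trans
        of_nat_0_less_iff of_nat_1 of_nat_eq_iff zero_less_one)
  then have "{0<..} \<subseteq> closure S"
    by auto
  \<comment> \<open>Since S lies in the positive reals, its closure there is the trace of its
    closure in the whole line.\<close>
  then have "top_of_set {0<..} closure_of S = {0<..}"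
    using S_pos by (auto simp: closure_of_subtopology Int_absorb1)
  then show ?thesis
    unfolding S_def .
qed

end
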